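(* Let $X(t)$, $t\in[0,1]$, be an $\alpha(\cdot)$-locally stationary random process whose smoothness index $\alpha(\cdot)$ satisfies: (C1) $\alpha(\cdot)$ attains its global minimum over $[0,1]$ at the unique point $0$; put $\alpha_0:=\alpha(0)$; (C2) there exist $b,\gamma>0$ such that $\alpha(t)=\alpha_0+b\,t^{\gamma}+o(t^{\gamma})$ as $t\to 0$. Let $p(t)$, $t\in[0,1]$, be a positive continuous probability density on $[0,1]$, and let $T_n=\{t_j(n),\ j=0,1,\dots,n\}$ be the regular sampling designs generated by $p$, i.e. $$\int_0^{t_j(n)}p(t)\,dt=\frac jn,\qquad 0\le j\le n.$$ Let $X_n$ be the piecewise constant approximations of $X$ corresponding to $T_n$. Then $$\int_0^1 \mathbb{E}\{(X(t)-X_n(t))^2\}\,dt\;\sim\;\frac{K_1}{n^{\alpha_0}(\log n)^{1/\gamma}}\qquad\text{as } n\to\infty,$$ where $$K_1:=\frac{c(0)}{\alpha_0+1}\;\frac{\Gamma(1/\gamma+1)}{p(0)^{\alpha_0}\,b^{1/\gamma}}$$ and $c(\cdot)$ is the function from the definition of $\alpha(\cdot)$-local stationarity.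
   Context: Write $\|Y\|:=(\mathbb{E}Y^2)^{1/2}$ for a random variable $Y$. A random process $X(t)$, $t\in[0,1]$, with $\mathbb{E}\{X(t)^2\}<\infty$ is called $\alpha(\cdot)$-locally stationary if there are continuous functions $\alpha(\cdot),c(\cdot)$ on $[0,1]$ with $0<\alpha(t)\le 2$ and $c(t)>0$ such that $$\lim_{s\to0}\frac{\|X(t+s)-X(t)\|^2}{|s|^{\alpha(t)}}=c(t)\quad\text{uniformly in } t\in[0,1]$$ (with $s\neq 0$ and $t+s\in[0,1]$). Given knots $0=t_0<t_1<\dots<t_N=1$ (a sampling design), the piecewise constant approximation is $X_n(t):=X(t_{j-1})$ for $t_{j-1}\le t<t_j$, $j=1,\dots,N$ (here $N=n$). $\Gamma$ is the Gamma function; $a_n\sim b_n$ means $a_n/b_n\to1$. *)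

theory Defs
  imports "HOL-Probability.Probability" "HOL-Library.Landau_Symbols"
begin

definition rv_norm :: "'a measure \<Rightarrow> ('a \<Rightarrow> real) \<Rightarrow> real" where
  "rv_norm M Y = sqrt (\<integral>\<omega>. (Y \<omega>)\<^sup>2 \<partial>M)"

definition second_order_process :: "'a measure \<Rightarrow> (real \<Rightarrow> 'a \<Rightarrow> real) \<Rightarrow> bool" where
  "second_order_process M X \<longleftrightarrow>
     prob_space M \<and>
     (\<forall>t\<in>{0..1}. X t \<in> borel_measurable M \<and> integrable M (\<lambda>\<omega>. (X t \<omega>)\<^sup>2))"

text \<open>
  The last clause is \<^const>\<open>uniform_limit\<close> on \<open>{0..1}\<close> along \<open>at 0\<close>, written out because for each
  \<open>s\<close> only those \<open>t\<close> with \<open>t + s \<in> {0..1}\<close> are considered.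
\<close>
definition locally_stationary ::
    "'a measure \<Rightarrow> (real \<Rightarrow> real) \<Rightarrow> (real \<Rightarrow> real) \<Rightarrow> (real \<Rightarrow> 'a \<Rightarrow> real) \<Rightarrow> bool" where
  "locally_stationary M \<alpha> c X \<longleftrightarrow>
     second_order_process M X \<and>
     continuous_on {0..1} \<alpha> \<and> continuous_on {0..1} c \<and>
     (\<forall>t\<in>{0..1}. 0 < \<alpha> t \<and> \<alpha> t \<le> 2 \<and> 0 < c t) \<and>
     (\<forall>\<epsilon>>0. \<forall>\<^sub>F s in at 0. \<forall>t\<in>{0..1}. t + s \<in> {0..1} \<longrightarrow>
        dist ((rv_norm M (\<lambda>\<omega>. X (t + s) \<omega> - X t \<omega>))\<^sup>2 / \<bar>s\<bar> powr \<alpha> t) (c t) < \<epsilon>)"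

definition sampling_design :: "nat \<Rightarrow> (nat \<Rightarrow> real) \<Rightarrow> bool" where
  "sampling_design N \<tau> \<longleftrightarrow> \<tau> 0 = 0 \<and> \<tau> N = 1 \<and> (\<forall>j<N. \<tau> j < \<tau> (Suc j))"

definition regular_design :: "(real \<Rightarrow> real) \<Rightarrow> nat \<Rightarrow> (nat \<Rightarrow> real) \<Rightarrow> bool" where
  "regular_design p n \<tau> \<longleftrightarrow>
     sampling_design n \<tau> \<and> (\<forall>j\<le>n. (LBINT t:{0..\<tau> j}. p t) = real j / real n)"

text \<open>
  The half-open pieces do not cover the endpoint \<open>1\<close>, so \<open>Y 1\<close> is left arbitrary.
\<close>
definition piecewise_constant_approx ::
    "(real \<Rightarrow> 'a \<Rightarrow> real) \<Rightarrow> nat \<Rightarrow> (nat \<Rightarrow> real) \<Rightarrow> (real \<Rightarrow> 'a \<Rightarrow> real) \<Rightarrow> bool" where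
  "piecewise_constant_approx X N \<tau> Y \<longleftrightarrow>
     (\<forall>j\<in>{1..N}. \<forall>t. \<tau> (j - 1) \<le> t \<and> t < \<tau> j \<longrightarrow> Y t = X (\<tau> (j - 1)))"

definition positive_continuous_density :: "(real \<Rightarrow> real) \<Rightarrow> bool" where
  "positive_continuous_density p \<longleftrightarrow>
     continuous_on {0..1} p \<and> (\<forall>t\<in>{0..1}. 0 < p t) \<and> (LBINT t:{0..1}. p t) = 1"

end

theory Submission
  imports Defs "HOL-Real_Asymp.Real_Asymp"
begin

text \<open>
  On a cell of length \<open>h\<close> with left endpoint \<open>t\<close>, local stationarity makes the mean of
  \<open>E (X(t + s) - X(t))\<^sup>2\<close> over \<open>0 \<le> s \<le> h\<close> close to \<open>c(t) h powr \<alpha>(t) / (\<alpha>(t) + 1)\<close>, and a regular design has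
  \<open>h \<approx> 1 / (n p(t))\<close>. So the error density at \<open>t\<close> is about
  \<open>c(t) / (\<alpha>(t) + 1) \<cdot> p(t) powr (- \<alpha>(t)) \<cdot> n powr (- \<alpha>(t))\<close>. Because \<open>\<alpha>\<close> is smallest at \<open>0\<close> only, the
  factor \<open>n powr (- \<alpha>(t)) = n powr (- \<alpha>\<^sub>0) exp (- (\<alpha>(t) - \<alpha>\<^sub>0) ln n)\<close> concentrates the error at \<open>0\<close>, as in Laplace's
  method: with \<open>\<alpha>(t) - \<alpha>\<^sub>0 \<approx> b t\<^sup>\<gamma>\<close> and \<open>t = u (ln n) powr (- 1/\<gamma>)\<close> the last factor becomes \<open>exp (- b u\<^sup>\<gamma>)\<close>,
  whose integral over \<open>u \<ge> 0\<close> is \<open>\<Gamma>(1/\<gamma> + 1) / b powr (1/\<gamma>)\<close>.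

  The proof makes this exact by dominated convergence. The piecewise averages of the error, multiplied by \<open>n powr \<alpha>\<^sub>0\<close>
  and regarded as a step function of \<open>u\<close> (\<open>rescaled_error\<close>), have \<open>n powr \<alpha>\<^sub>0 (ln n) powr (1/\<gamma>)\<close> times the
  total error as their integral. They converge pointwise (\<open>rescaled_error_limit\<close>), which uses only the
  behaviour of \<open>\<alpha>\<close>, \<open>c\<close> and \<open>p\<close> at \<open>0\<close>, and a global lower bound \<open>\<alpha>(t) \<ge> \<alpha>\<^sub>0 + \<beta> t\<^sup>\<gamma>\<close> provides an
  integrable dominating function (\<open>rescaled_error_dominated\<close>).
\<close>

section \<open>Two analytic ingredients\<close>

text \<open>
  The constant \<open>\<Gamma>(1/\<gamma> + 1) / b powr (1/\<gamma>)\<close> of the asymptotics comes from here: the substitution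
  \<open>t = b u\<^sup>\<gamma>\<close> turns Euler's integral for \<open>\<Gamma>(1/\<gamma>)\<close> into \<open>\<gamma> \<cdot> b powr (1/\<gamma>)\<close> times this one.
  The same lemma with another coefficient makes the dominating function integrable.
\<close>

lemma stretched_exponential_has_bochner_integral:
  fixes b \<gamma> :: real
  assumes "b > 0" "\<gamma> > 0"
  shows "has_bochner_integral lborel (\<lambda>u. indicator {0..} u * exp (- (b * u powr \<gamma>)))
           (Gamma (1 / \<gamma> + 1) / b powr (1 / \<gamma>))"
proof -
  let ?f = "\<lambda>t::real. t powr (1 / \<gamma> - 1) / exp t"
  let ?g = "\<lambda>u::real. b * u powr \<gamma>"
  let ?g' = "\<lambda>u::real. b * (\<gamma> * u powr (\<gamma> - 1))"
  have open_ray: "(f has_integral y) {0..} \<longleftrightarrow> (f has_integral y) {0<..}" for f :: "real \<Rightarrow> real" and y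
    by (rule has_integral_spike_set_eq; rule negligible_subset[of "{0}"]; force)
  have img: "?g ` {0<..} = {0<..}"
  proof (intro equalityI subsetI)
    fix t :: real assume t: "t \<in> {0<..}"
    show "t \<in> ?g ` {0<..}"
      by (rule image_eqI[of _ _ "(t / b) powr (1 / \<gamma>)"]) (use assms t in \<open>simp_all add: powr_powr\<close>)
  qed (use assms in auto)
  have "(?f has_integral Gamma (1 / \<gamma>)) {0..}"
    using Gamma_integral_real[of "1 / \<gamma>"] assms by simp
  then have f: "(?f has_integral Gamma (1 / \<gamma>)) {0<..}"
    using open_ray by blast
  have "?f absolutely_integrable_on {0<..}"
    by (rule nonnegative_absolutely_integrable_1) (use f in \<open>auto simp: integrable_on_def\<close>)
  moreover have "integral {0<..} ?f = Gamma (1 / \<gamma>)"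
    using f by (rule integral_unique)
  moreover have "inj_on ?g {0<..}"
  proof (rule inj_onI)
    fix x y :: real assume "x \<in> {0<..}" "y \<in> {0<..}" "b * x powr \<gamma> = b * y powr \<gamma>"
    then have "(x powr \<gamma>) powr (1 / \<gamma>) = (y powr \<gamma>) powr (1 / \<gamma>)" "x > 0" "y > 0"
      using assms by auto
    then show "x = y" using assms by (simp add: powr_powr)
  qed
  moreover have "(?g has_field_derivative ?g' x) (at x within {0<..})" if "x \<in> {0<..}" for x
    using that by (auto intro!: derivative_eq_intros)
  ultimately have cov: "(\<lambda>x. \<bar>?g' x\<bar> * ?f (?g x)) absolutely_integrable_on {0<..}"
    "integral {0<..} (\<lambda>x. \<bar>?g' x\<bar> * ?f (?g x)) = Gamma (1 / \<gamma>)"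
    using has_absolute_integral_change_of_variables_1'[of "{0<..}" ?g ?g' ?f "Gamma (1 / \<gamma>)"]
    unfolding img by auto
  have eq: "\<bar>?g' x\<bar> * ?f (?g x) = (\<gamma> * b powr (1 / \<gamma>)) * exp (- (b * x powr \<gamma>))"
    if "x \<in> {0<..}" for x
  proof -
    have "x powr (\<gamma> - 1) * (b * x powr \<gamma>) powr (1 / \<gamma> - 1)
        = b powr (1 / \<gamma> - 1) * x powr ((\<gamma> - 1) + \<gamma> * (1 / \<gamma> - 1))"
      using that assms by (simp add: powr_mult powr_powr powr_add)
    also have "(\<gamma> - 1) + \<gamma> * (1 / \<gamma> - 1) = 0"
      using assms by (simp add: field_simps)
    finally have "x powr (\<gamma> - 1) * (b * x powr \<gamma>) powr (1 / \<gamma> - 1) = b powr (1 / \<gamma> - 1)"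
      using that by simp
    moreover have "b * b powr (1 / \<gamma> - 1) = b powr (1 / \<gamma>)"
      using assms by (simp add: powr_diff)
    ultimately show ?thesis
      using that assms by (simp add: exp_minus field_simps)
  qed
  have "((\<lambda>x. \<bar>?g' x\<bar> * ?f (?g x)) has_integral Gamma (1 / \<gamma>)) {0<..}"
    using cov set_lebesgue_integral_eq_integral(1)[OF cov(1)] by (simp only: has_integral_iff)
  then have "((\<lambda>x. (\<gamma> * b powr (1 / \<gamma>)) * exp (- (b * x powr \<gamma>))) has_integral Gamma (1 / \<gamma>)) {0<..}"
    by (subst (asm) has_integral_cong[OF eq])
  from has_integral_mult_right[OF this, of "1 / (\<gamma> * b powr (1 / \<gamma>))"]
  have "((\<lambda>x. exp (- (b * x powr \<gamma>))) has_integral Gamma (1 / \<gamma>) / (\<gamma> * b powr (1 / \<gamma>))) {0<..}"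
    using assms by simp
  moreover have "Gamma (1 / \<gamma>) / (\<gamma> * b powr (1 / \<gamma>)) = Gamma (1 / \<gamma> + 1) / b powr (1 / \<gamma>)"
  proof -
    have "1 / \<gamma> \<notin> \<int>\<^sub>\<le>\<^sub>0"
      using assms nonpos_Ints_nonpos[of "1 / \<gamma>"] by (auto simp: divide_le_0_iff)
    then show ?thesis using assms by (simp add: Gamma_plus1)
  qed
  ultimately have "((\<lambda>x. exp (- (b * x powr \<gamma>))) has_integral Gamma (1 / \<gamma> + 1) / b powr (1 / \<gamma>)) {0..}"
    unfolding open_ray by simp
  then have "((\<lambda>x. if x \<in> {0..} then exp (- (b * x powr \<gamma>)) else 0)
      has_integral Gamma (1 / \<gamma> + 1) / b powr (1 / \<gamma>)) UNIV"
    by (simp only: has_integral_restrict_UNIV)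
  moreover have "(\<lambda>x. if x \<in> {0..} then exp (- (b * x powr \<gamma>)) else 0)
      = (\<lambda>x. indicator {0..} x * exp (- (b * x powr \<gamma>)))"
    by auto
  ultimately have UNIV: "((\<lambda>x. indicator {0..} x * exp (- (b * x powr \<gamma>)))
      has_integral Gamma (1 / \<gamma> + 1) / b powr (1 / \<gamma>)) UNIV"
    by simp
  from nn_integral_has_integral_lborel[OF _ _ UNIV]
  have "(\<integral>\<^sup>+ x. ennreal (indicator {0..} x * exp (- (b * x powr \<gamma>))) \<partial>lborel)
      = ennreal (Gamma (1 / \<gamma> + 1) / b powr (1 / \<gamma>))"
    by simp
  moreover have "Gamma (1 / \<gamma> + 1) > 0"
    using assms by (intro Gamma_real_pos add_pos_pos) auto
  ultimately show ?thesis
    by (intro has_bochner_integral_nn_integral) auto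
qed

text \<open>
  The expansion at \<open>0\<close> gives the bound on a neighbourhood of \<open>0\<close>; on the compact rest of the interval
  \<open>\<alpha> - \<alpha> 0\<close> has a positive minimum, and \<open>t\<^sup>\<gamma> \<le> 1\<close>. A bound on all of \<open>[0,1]\<close> allows
  the cells near \<open>0\<close> and the cells far from \<open>0\<close> to be dominated together.
\<close>

lemma exponent_lower_bound:
  fixes \<alpha> :: "real \<Rightarrow> real" and b \<gamma> :: real
  assumes cont: "continuous_on {0..1} \<alpha>"
    and min: "\<And>t. t \<in> {0<..1} \<Longrightarrow> \<alpha> 0 < \<alpha> t"
    and "b > 0" "\<gamma> > 0"
    and exp0: "(\<lambda>t. \<alpha> t - (\<alpha> 0 + b * t powr \<gamma>)) \<in> o[at_right 0](\<lambda>t. t powr \<gamma>)"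
  obtains \<beta> where "\<beta> > 0" "\<And>t. t \<in> {0..1} \<Longrightarrow> \<alpha> 0 + \<beta> * t powr \<gamma> \<le> \<alpha> t"
proof -
  have "eventually (\<lambda>t. norm (\<alpha> t - (\<alpha> 0 + b * t powr \<gamma>)) \<le> b / 2 * norm (t powr \<gamma>)) (at_right 0)"
    using landau_o.smallD[OF exp0, of "b / 2"] \<open>b > 0\<close> by simp
  then obtain \<delta> where \<delta>: "\<delta> > 0"
    "\<And>t. 0 < t \<Longrightarrow> t < \<delta> \<Longrightarrow> \<bar>\<alpha> t - (\<alpha> 0 + b * t powr \<gamma>)\<bar> \<le> b / 2 * t powr \<gamma>"
    unfolding eventually_at_right_field by auto
  define d where "d = min \<delta> 1"
  have d: "0 < d" "d \<le> 1" "d \<le> \<delta>" using \<delta>(1) by (auto simp: d_def)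
  have "continuous_on {d..1} \<alpha>"
    using cont by (rule continuous_on_subset) (use d in auto)
  then obtain x where x: "x \<in> {d..1}" "\<And>y. y \<in> {d..1} \<Longrightarrow> \<alpha> x \<le> \<alpha> y"
    using continuous_attains_inf[of "{d..1}" \<alpha>] d by auto
  have m: "\<alpha> x - \<alpha> 0 > 0" using min[of x] x(1) d by auto
  show ?thesis
  proof (rule that[of "min (b / 2) (\<alpha> x - \<alpha> 0)"])
    show "0 < min (b / 2) (\<alpha> x - \<alpha> 0)" using m \<open>b > 0\<close> by simp
    fix t :: real assume t: "t \<in> {0..1}"
    consider "t = 0" | "0 < t" "t < d" | "d \<le> t" using t by force
    then show "\<alpha> 0 + min (b / 2) (\<alpha> x - \<alpha> 0) * t powr \<gamma> \<le> \<alpha> t"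
    proof cases
      case 1 then show ?thesis by simp
    next
      case 2
      have "min (b / 2) (\<alpha> x - \<alpha> 0) * t powr \<gamma> \<le> b / 2 * t powr \<gamma>"
        by (intro mult_right_mono min.cobounded1) simp
      moreover have "\<bar>\<alpha> t - (\<alpha> 0 + b * t powr \<gamma>)\<bar> \<le> b / 2 * t powr \<gamma>"
        using \<delta>(2)[of t] 2 d by simp
      ultimately show ?thesis by linarith
    next
      case 3
      have "t powr \<gamma> \<le> 1" using t \<open>\<gamma> > 0\<close> powr_mono2[of \<gamma> t 1] by auto
      then have "min (b / 2) (\<alpha> x - \<alpha> 0) * t powr \<gamma> \<le> (\<alpha> x - \<alpha> 0) * 1"
        using m by (intro mult_mono) auto
      with x(2)[of t] 3 t show ?thesis by auto
    qed
  qed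
qed

section \<open>Averaging over a single cell\<close>

text \<open>
  Local stationarity is a pointwise statement about \<open>V t (t + s)\<close>; only its average over a
  cell enters the error. Integrating \<open>(c t \<plusminus> \<epsilon>) s\<^sup>\<alpha>\<close> over \<open>0 \<le> s \<le> h\<close> yields the factor
  \<open>1 / (\<alpha> t + 1)\<close>, with the same \<open>\<delta>\<close> for every left endpoint \<open>t\<close>.
\<close>

lemma cell_quotient_uniform:
  fixes V :: "real \<Rightarrow> real \<Rightarrow> real" and \<alpha> c :: "real \<Rightarrow> real"
  assumes cont: "\<And>s. s \<in> {0..1} \<Longrightarrow> continuous_on {0..1} (V s)"
    and diag: "\<And>s. V s s = 0"
    and pos: "\<And>t. t \<in> {0..1} \<Longrightarrow> \<alpha> t > 0"
    and loc: "\<And>\<epsilon>. \<epsilon> > 0 \<Longrightarrow> \<exists>\<delta>>0. \<forall>t\<in>{0..1}. \<forall>s. 0 < s \<and> s < \<delta> \<and> t + s \<le> 1 \<longrightarrow>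
              \<bar>V t (t + s) / s powr \<alpha> t - c t\<bar> < \<epsilon>"
    and "\<epsilon> > 0"
  shows "\<exists>\<delta>>0. \<forall>t\<in>{0..1}. \<forall>h. 0 < h \<and> h < \<delta> \<and> t + h \<le> 1 \<longrightarrow>
           \<bar>integral {t..t + h} (V t) / h / h powr \<alpha> t - c t / (\<alpha> t + 1)\<bar> \<le> \<epsilon>"
proof -
  from loc[OF \<open>\<epsilon> > 0\<close>] obtain \<delta> where \<delta>: "\<delta> > 0"
    "\<And>t s. t \<in> {0..1} \<Longrightarrow> 0 < s \<Longrightarrow> s < \<delta> \<Longrightarrow> t + s \<le> 1 \<Longrightarrow> \<bar>V t (t + s) / s powr \<alpha> t - c t\<bar> < \<epsilon>"
    by blast
  show ?thesis
  proof (intro exI[of _ \<delta>] conjI ballI allI impI \<delta>(1); elim conjE)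
    fix t h :: real assume t: "t \<in> {0..1}" and h: "0 < h" "h < \<delta>" "t + h \<le> 1"
    note a = pos[OF t]
    define P where "P = h powr (\<alpha> t + 1) / (\<alpha> t + 1)"
    have pw: "((\<lambda>x. (x - t) powr \<alpha> t) has_integral P) {t..t + h}"
    proof -
      have "((\<lambda>x. x powr \<alpha> t) has_integral P) (cbox 0 h)"
        using has_integral_powr_from_0[of "\<alpha> t" h] a h by (simp add: P_def)
      from has_integral_affinity[OF this, of 1 "- t"] h show ?thesis
        by (simp add: add.commute)
    qed
    have Vi: "V t integrable_on {t..t + h}"
      by (intro integrable_continuous_interval continuous_on_subset[OF cont[OF t]]) (use t h in auto)
    have bd: "(c t - \<epsilon>) * (x - t) powr \<alpha> t \<le> V t x \<and> V t x \<le> (c t + \<epsilon>) * (x - t) powr \<alpha> t"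
      if "x \<in> {t..t + h}" for x
    proof (cases "x = t")
      case False
      then have "0 < x - t" "x - t < \<delta>" "t + (x - t) \<le> 1" using that h by auto
      from \<delta>(2)[OF t this] \<open>0 < x - t\<close> show ?thesis
        by (simp add: abs_less_iff field_simps)
    qed (simp add: diag)
    have "(c t - \<epsilon>) * P \<le> integral {t..t + h} (V t)" "integral {t..t + h} (V t) \<le> (c t + \<epsilon>) * P"
      using has_integral_le[OF has_integral_mult_right[OF pw, of "c t - \<epsilon>"] integrable_integral[OF Vi]] bd
        has_integral_le[OF integrable_integral[OF Vi] has_integral_mult_right[OF pw, of "c t + \<epsilon>"]]
      by auto
    then have "\<bar>integral {t..t + h} (V t) - c t * P\<bar> \<le> \<epsilon> * P"
      by (simp add: abs_le_iff algebra_simps)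
    moreover have "P = h * h powr \<alpha> t / (\<alpha> t + 1)"
      using h by (simp add: P_def powr_add)
    moreover define R where "R = h * h powr \<alpha> t"
    ultimately have 1: "\<bar>integral {t..t + h} (V t) - c t * R / (\<alpha> t + 1)\<bar> \<le> \<epsilon> * R / (\<alpha> t + 1)"
      and R: "R > 0"
      using h by auto
    have "\<bar>integral {t..t + h} (V t) / h / h powr \<alpha> t - c t / (\<alpha> t + 1)\<bar>
        = \<bar>integral {t..t + h} (V t) - c t * R / (\<alpha> t + 1)\<bar> / R"
    proof -
      have "integral {t..t + h} (V t) / h / h powr \<alpha> t - c t / (\<alpha> t + 1)
        = (integral {t..t + h} (V t) - c t * R / (\<alpha> t + 1)) / R"
        using R h by (simp add: R_def diff_divide_distrib)
      with R show ?thesis by (simp add: abs_divide)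
    qed
    also have "\<dots> \<le> \<epsilon> / (\<alpha> t + 1)"
      using 1 R by (simp add: divide_le_eq)
    also have "\<dots> \<le> \<epsilon>"
      using a \<open>\<epsilon> > 0\<close> by (simp add: divide_le_eq)
    finally show "\<bar>integral {t..t + h} (V t) / h / h powr \<alpha> t - c t / (\<alpha> t + 1)\<bar> \<le> \<epsilon>" .
  qed
qed

section \<open>Sampling designs\<close>

lemma sampling_design_mono:
  assumes "sampling_design n \<tau>" "i \<le> j" "j \<le> n"
  shows "\<tau> i \<le> \<tau> j"
  using assms(2,3)
proof (induction j rule: dec_induct)
  case (step j) 
  then show ?case using assms(1) by (auto simp: sampling_design_def intro: order_trans[OF _ less_imp_le])
qed simp

lemma sampling_design_range:
  assumes "sampling_design n \<tau>" "j \<le> n"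
  shows "\<tau> j \<in> {0..1}"
  using sampling_design_mono[OF assms(1), of 0 j] sampling_design_mono[OF assms(1), of j n] assms
  by (auto simp: sampling_design_def)

lemma sampling_design_cell_exists:
  assumes "sampling_design n \<tau>" "0 \<le> x" "x < 1"
  obtains j where "j < n" "\<tau> j \<le> x" "x < \<tau> (Suc j)"
proof -
  define k where "k = (LEAST k. x < \<tau> k)"
  have "x < \<tau> n" using assms by (simp add: sampling_design_def)
  then have k: "x < \<tau> k" "k \<le> n" unfolding k_def by (auto intro: LeastI Least_le)
  have "k \<noteq> 0" using k assms by (auto simp: sampling_design_def intro!: Nat.gr0I)
  then obtain j where j: "k = Suc j" by (cases k) auto
  then have "\<not> x < \<tau> j" using not_less_Least[of j "\<lambda>k. x < \<tau> k"] by (simp add: k_def)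
  with k j show ?thesis by (intro that[of j]) auto
qed

lemma sampling_design_cell_unique:
  assumes "sampling_design n \<tau>" "i < n" "j < n"
    and "\<tau> i \<le> x" "x < \<tau> (Suc i)" "\<tau> j \<le> x" "x < \<tau> (Suc j)"
  shows "i = j"
  using sampling_design_mono[OF assms(1), of "Suc i" j] sampling_design_mono[OF assms(1), of "Suc j" i] assms
  by (cases i j rule: linorder_cases) auto

text \<open>
  Each cell carries \<open>p\<close>-mass \<open>1 / n\<close>, so the mean value theorem for the distribution
  function of \<open>p\<close> determines its length up to the choice of a point in the cell.
\<close>

lemma regular_design_cell_length:
  assumes p: "positive_continuous_density p" and d: "regular_design p n \<tau>" and j: "j < n"
  obtains \<xi> where "\<tau> j \<le> \<xi>" "\<xi> \<le> \<tau> (Suc j)" "real n * (\<tau> (Suc j) - \<tau> j) * p \<xi> = 1"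
proof -
  have sd: "sampling_design n \<tau>" using d by (simp add: regular_design_def)
  have cont: "continuous_on {0..1} p" using p by (simp add: positive_continuous_density_def)
  define F where "F = (\<lambda>x. integral {0..x} p)"
  have F: "F (\<tau> k) = real k / real n" if "k \<le> n" for k
  proof -
    have "set_integrable lborel {0..\<tau> k} p"
      using sampling_design_range[OF sd that]
      by (intro borel_integrable_compact[unfolded set_integrable_def[symmetric]] continuous_on_subset[OF cont])
         auto
    then show ?thesis
      using d that by (simp add: F_def regular_design_def flip: set_borel_integral_eq_integral(2))
  qed
  have lt: "\<tau> j < \<tau> (Suc j)" using sd j by (simp add: sampling_design_def)
  have r: "0 \<le> \<tau> j" "\<tau> (Suc j) \<le> 1"
    using sampling_design_range[OF sd, of j] sampling_design_range[OF sd, of "Suc j"] j by auto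
  have "(F has_derivative (\<lambda>h. p x * h)) (at x within {\<tau> j..\<tau> (Suc j)})"
    if "\<tau> j \<le> x" "x \<le> \<tau> (Suc j)" for x
    using integral_has_real_derivative[OF cont, of x] that r
    unfolding F_def has_field_derivative_def
    by (auto intro: has_derivative_subset)
  from mvt_simple[OF lt this]
  obtain z where z: "\<tau> j < z" "z < \<tau> (Suc j)" "F (\<tau> (Suc j)) - F (\<tau> j) = p z * (\<tau> (Suc j) - \<tau> j)"
    by auto
  then have "p z * (\<tau> (Suc j) - \<tau> j) = 1 / real n"
    using F[of j] F[of "Suc j"] j by (simp add: field_simps)
  then show ?thesis
    using z j by (intro that[of z]) (auto simp: field_simps)
qed

section \<open>The variogram of a locally stationary process\<close>

text \<open>
  Young's inequality for the mixed term \<open>2 x y\<close>. After integration it replaces the triangle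
  inequality of \<open>L\<^sup>2\<close> in the proof that the variogram is continuous.
\<close>

lemma square_sum_diff_bound:
  fixes x y \<eta> :: real
  assumes "\<eta> > 0"
  shows "\<bar>(x + y)\<^sup>2 - x\<^sup>2\<bar> \<le> \<eta> * x\<^sup>2 + (1 + 1 / \<eta>) * y\<^sup>2"
proof -
  have "0 \<le> (\<eta> * x - y)\<^sup>2 / \<eta>" "0 \<le> (\<eta> * x + y)\<^sup>2 / \<eta>"
    using assms by auto
  then have "2 * x * y \<le> \<eta> * x\<^sup>2 + y\<^sup>2 / \<eta>" "- (2 * x * y) \<le> \<eta> * x\<^sup>2 + y\<^sup>2 / \<eta>"
    using assms by (auto simp: power2_eq_square field_simps)
  moreover have "(x + y)\<^sup>2 - x\<^sup>2 = 2 * x * y + y\<^sup>2"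
    by (simp add: power2_eq_square algebra_simps)
  moreover have "(1 + 1 / \<eta>) * y\<^sup>2 = y\<^sup>2 + y\<^sup>2 / \<eta>"
    by (simp add: algebra_simps)
  ultimately show ?thesis
    using zero_le_power2[of y] unfolding abs_le_iff by linarith
qed

definition variogram :: "'a measure \<Rightarrow> (real \<Rightarrow> 'a \<Rightarrow> real) \<Rightarrow> real \<Rightarrow> real \<Rightarrow> real" where
  "variogram M X s t = (\<integral>\<omega>. (X t \<omega> - X s \<omega>)\<^sup>2 \<partial>M)"

lemma variogram_nonneg: "variogram M X s t \<ge> 0"
  by (simp add: variogram_def)

lemma variogram_diag [simp]: "variogram M X s s = 0"
  by (simp add: variogram_def)

lemma second_order_increment_integrable:
  assumes "second_order_process M X" "s \<in> {0..1}" "t \<in> {0..1}"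
  shows "integrable M (\<lambda>\<omega>. (X t \<omega> - X s \<omega>)\<^sup>2)"
proof (rule Bochner_Integration.integrable_bound)
  show "integrable M (\<lambda>\<omega>. 2 * (X t \<omega>)\<^sup>2 + 2 * (X s \<omega>)\<^sup>2)"
    using assms by (auto simp: second_order_process_def)
  have [measurable]: "X s \<in> borel_measurable M" "X t \<in> borel_measurable M"
    using assms by (auto simp: second_order_process_def)
  show "(\<lambda>\<omega>. (X t \<omega> - X s \<omega>)\<^sup>2) \<in> borel_measurable M"
    by measurable
  have "(x - y)\<^sup>2 \<le> 2 * x\<^sup>2 + 2 * y\<^sup>2" for x y :: real
    using zero_le_power2[of "x + y"] by (simp add: power2_eq_square algebra_simps)
  then show "AE \<omega> in M. norm ((X t \<omega> - X s \<omega>)\<^sup>2) \<le> norm (2 * (X t \<omega>)\<^sup>2 + 2 * (X s \<omega>)\<^sup>2)"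
    by simp
qed

lemma locally_stationary_variogram:
  assumes "locally_stationary M \<alpha> c X" "\<epsilon> > 0"
  obtains \<delta> where "\<delta> > 0"
    "\<And>s t. t \<in> {0..1} \<Longrightarrow> t + s \<in> {0..1} \<Longrightarrow> s \<noteq> 0 \<Longrightarrow> \<bar>s\<bar> < \<delta> \<Longrightarrow>
       \<bar>variogram M X t (t + s) / \<bar>s\<bar> powr \<alpha> t - c t\<bar> < \<epsilon>"
proof -
  have "\<forall>\<^sub>F s in at 0. \<forall>t\<in>{0..1}. t + s \<in> {0..1} \<longrightarrow>
        dist ((rv_norm M (\<lambda>\<omega>. X (t + s) \<omega> - X t \<omega>))\<^sup>2 / \<bar>s\<bar> powr \<alpha> t) (c t) < \<epsilon>"
    using assms by (auto simp: locally_stationary_def)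
  moreover have "(rv_norm M (\<lambda>\<omega>. X (t + s) \<omega> - X t \<omega>))\<^sup>2 = variogram M X t (t + s)" for s t
    by (simp add: rv_norm_def variogram_def)
  ultimately obtain \<delta> where "\<delta> > 0"
    "\<And>s. s \<noteq> 0 \<Longrightarrow> dist s 0 < \<delta> \<Longrightarrow> \<forall>t\<in>{0..1}. t + s \<in> {0..1} \<longrightarrow>
        dist (variogram M X t (t + s) / \<bar>s\<bar> powr \<alpha> t) (c t) < \<epsilon>"
    unfolding eventually_at by auto
  then show ?thesis
    by (intro that[of \<delta>]) (auto simp: dist_real_def)
qed

text \<open>
  Mean-square continuity: near \<open>t\<close> the variogram is at most \<open>(c t + 1) \<bar>t' - t\<bar>\<^sup>\<alpha>\<close>,
  and \<open>\<alpha> t > 0\<close>.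
\<close>

lemma variogram_tendsto_0:
  assumes ls: "locally_stationary M \<alpha> c X" and t: "t \<in> {0..1}"
  shows "((\<lambda>t'. variogram M X t t') \<longlongrightarrow> 0) (at t within {0..1})"
proof (rule tendsto_sandwich)
  show "\<forall>\<^sub>F t' in at t within {0..1}. 0 \<le> variogram M X t t'"
    by (simp add: variogram_nonneg)
  obtain \<delta> where \<delta>: "\<delta> > 0"
    "\<And>s. t + s \<in> {0..1} \<Longrightarrow> s \<noteq> 0 \<Longrightarrow> \<bar>s\<bar> < \<delta> \<Longrightarrow>
       \<bar>variogram M X t (t + s) / \<bar>s\<bar> powr \<alpha> t - c t\<bar> < 1"
    using locally_stationary_variogram[OF ls zero_less_one] t by metis
  have "variogram M X t t' \<le> (c t + 1) * \<bar>t' - t\<bar> powr \<alpha> t"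
    if "t' \<in> {0..1}" "t' \<noteq> t" "dist t' t < \<delta>" for t'
    using \<delta>(2)[of "t' - t"] that by (simp add: dist_real_def abs_less_iff field_simps)
  then show "\<forall>\<^sub>F t' in at t within {0..1}. variogram M X t t' \<le> (c t + 1) * \<bar>t' - t\<bar> powr \<alpha> t"
    unfolding eventually_at using \<delta>(1) by blast
  have "\<alpha> t > 0" using ls t by (simp add: locally_stationary_def)
  then have "((\<lambda>t'. (c t + 1) * \<bar>t' - t\<bar> powr \<alpha> t) \<longlongrightarrow> (c t + 1) * \<bar>t - t\<bar> powr \<alpha> t) (at t within {0..1})"
    by (intro tendsto_intros tendsto_powr') auto
  then show "((\<lambda>t'. (c t + 1) * \<bar>t' - t\<bar> powr \<alpha> t) \<longlongrightarrow> 0) (at t within {0..1})"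
    using \<open>\<alpha> t > 0\<close> by simp
qed simp

text \<open>
  The approximation error is the integral of this function over a cell, and
  its integrability in \<open>t\<close> rests on continuity.
\<close>

lemma variogram_continuous:
  assumes ls: "locally_stationary M \<alpha> c X" and s: "s \<in> {0..1}"
  shows "continuous_on {0..1} (variogram M X s)"
  unfolding continuous_on_def tendsto_iff
proof (intro ballI allI impI)
  fix t \<epsilon> :: real assume t: "t \<in> {0..1}" and \<epsilon>: "\<epsilon> > 0"
  have so: "second_order_process M X" using ls by (simp add: locally_stationary_def)
  define \<eta> where "\<eta> = \<epsilon> / (2 * (variogram M X s t + 1))"
  have v: "variogram M X s t + 1 > 0" using variogram_nonneg[of M X s t] by simp
  then have \<eta>: "\<eta> > 0" using \<epsilon> by (simp add: \<eta>_def)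
  have "\<eta> * variogram M X s t = \<epsilon> / 2 - \<eta>"
    using v by (simp add: \<eta>_def field_simps)
  then have small: "\<eta> * variogram M X s t < \<epsilon> / 2" using \<eta> by simp
  have diff: "\<bar>variogram M X s t' - variogram M X s t\<bar> \<le> \<eta> * variogram M X s t + (1 + 1 / \<eta>) * variogram M X t t'"
    if t': "t' \<in> {0..1}" for t'
  proof -
    note int = second_order_increment_integrable[OF so]
    have "\<bar>variogram M X s t' - variogram M X s t\<bar> 
        = \<bar>\<integral>\<omega>. (X t' \<omega> - X s \<omega>)\<^sup>2 - (X t \<omega> - X s \<omega>)\<^sup>2 \<partial>M\<bar>"
      using int s t t' by (simp add: variogram_def)
    also have "\<dots> \<le> (\<integral>\<omega>. \<bar>(X t' \<omega> - X s \<omega>)\<^sup>2 - (X t \<omega> - X s \<omega>)\<^sup>2\<bar> \<partial>M)"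
      by (rule integral_abs_bound)
    also have "\<dots> \<le> (\<integral>\<omega>. \<eta> * (X t \<omega> - X s \<omega>)\<^sup>2 + (1 + 1 / \<eta>) * (X t' \<omega> - X t \<omega>)\<^sup>2 \<partial>M)"
    proof (rule integral_mono)
      fix \<omega>
      show "\<bar>(X t' \<omega> - X s \<omega>)\<^sup>2 - (X t \<omega> - X s \<omega>)\<^sup>2\<bar>
          \<le> \<eta> * (X t \<omega> - X s \<omega>)\<^sup>2 + (1 + 1 / \<eta>) * (X t' \<omega> - X t \<omega>)\<^sup>2"
        using square_sum_diff_bound[OF \<eta>, of "X t \<omega> - X s \<omega>" "X t' \<omega> - X t \<omega>"] by simp
    qed (use int s t t' in auto)
    also have "\<dots> = \<eta> * variogram M X s t + (1 + 1 / \<eta>) * variogram M X t t'"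
      using int s t t' by (simp add: variogram_def)
    finally show ?thesis .
  qed
  have "((\<lambda>t'. (1 + 1 / \<eta>) * variogram M X t t') \<longlongrightarrow> (1 + 1 / \<eta>) * 0) (at t within {0..1})"
    by (intro tendsto_intros variogram_tendsto_0[OF ls t])
  then have "\<forall>\<^sub>F t' in at t within {0..1}. (1 + 1 / \<eta>) * variogram M X t t' < \<epsilon> / 2"
    using \<epsilon> by (intro order_tendstoD(2)[where y = "(1 + 1 / \<eta>) * 0"]) auto
  moreover have "\<forall>\<^sub>F t' in at t within {0..1}. t' \<in> {0..1}"
    by (simp add: eventually_at_filter)
  ultimately show "\<forall>\<^sub>F t' in at t within {0..1}. dist (variogram M X s t') (variogram M X s t) < \<epsilon>"
  proof eventually_elim
    case (elim t')
    with diff[of t'] small show ?case unfolding dist_real_def by linarith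
  qed
qed

text \<open>
  The sum over the cells is formed with half-open cells, which partition \<open>[0, 1)\<close>; the value of
  \<open>f\<close> at the right end \<open>1\<close> is arbitrary and contributes nothing.
\<close>

lemma piecewise_continuous_integral:
  fixes f :: "real \<Rightarrow> real" and G :: "nat \<Rightarrow> real \<Rightarrow> real"
  assumes sd: "sampling_design n \<tau>"
    and cont: "\<And>j. j < n \<Longrightarrow> continuous_on {\<tau> j..\<tau> (Suc j)} (G j)"
    and eq: "\<And>j t. j < n \<Longrightarrow> \<tau> j \<le> t \<Longrightarrow> t < \<tau> (Suc j) \<Longrightarrow> f t = G j t"
  shows "(LBINT t:{0..1}. f t) = (\<Sum>j<n. integral {\<tau> j..\<tau> (Suc j)} (G j))"
proof -
  have cell: "set_integrable lborel {\<tau> j..<\<tau> (Suc j)} f"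
    "(LBINT t:{\<tau> j..<\<tau> (Suc j)}. f t) = integral {\<tau> j..\<tau> (Suc j)} (G j)" if j: "j < n" for j
  proof -
    have "set_integrable lborel {\<tau> j..\<tau> (Suc j)} (G j)"
      using borel_integrable_compact[OF _ cont[OF j]]
      by (simp add: set_integrable_def)
    then have G: "set_integrable lborel {\<tau> j..<\<tau> (Suc j)} (G j)"
      by (rule set_integrable_subset) auto
    then show "set_integrable lborel {\<tau> j..<\<tau> (Suc j)} f"
      by (subst set_integrable_cong[OF refl refl, of _ f "G j"]) (use eq[OF j] in auto)
    have "(LBINT t:{\<tau> j..<\<tau> (Suc j)}. f t) = (LBINT t:{\<tau> j..<\<tau> (Suc j)}. G j t)"
      by (intro set_lebesgue_integral_cong) (use eq[OF j] in auto)
    also have "\<dots> = integral {\<tau> j..<\<tau> (Suc j)} (G j)"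
      by (rule set_borel_integral_eq_integral(2)[OF G])
    also have "\<dots> = integral {\<tau> j..\<tau> (Suc j)} (G j)"
      by (rule integral_spike_set; rule negligible_subset[of "{\<tau> (Suc j)}"]; force)
    finally show "(LBINT t:{\<tau> j..<\<tau> (Suc j)}. f t) = integral {\<tau> j..\<tau> (Suc j)} (G j)" .
  qed
  have "set_integrable lborel {0..<\<tau> k} f \<and>
      (LBINT t:{0..<\<tau> k}. f t) = (\<Sum>j<k. integral {\<tau> j..\<tau> (Suc j)} (G j))" if "k \<le> n" for k
    using that
  proof (induction k)
    case 0
    then show ?case
      using sd by (simp add: sampling_design_def set_integrable_def set_lebesgue_integral_def)
  next
    case (Suc k)
    then have IH: "set_integrable lborel {0..<\<tau> k} f"
      "(LBINT t:{0..<\<tau> k}. f t) = (\<Sum>j<k. integral {\<tau> j..\<tau> (Suc j)} (G j))" and k: "k < n"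
      by auto
    have un: "{0..<\<tau> (Suc k)} = {0..<\<tau> k} \<union> {\<tau> k..<\<tau> (Suc k)}"
      using sampling_design_range[OF sd, of k] sampling_design_mono[OF sd, of k "Suc k"] k by auto
    show ?case
      unfolding un using IH cell[OF k]
      by (auto simp: set_integral_Un intro!: set_integrable_Un)
  qed
  from this[of n] have main: "set_integrable lborel {0..<1} f"
    "(LBINT t:{0..<1}. f t) = (\<Sum>j<n. integral {\<tau> j..\<tau> (Suc j)} (G j))"
    using sd by (auto simp: sampling_design_def)
  have "(\<lambda>t. indicator {1} t *\<^sub>R f t) = (\<lambda>t::real. indicator {1} t * f 1)"
    by (auto simp: indicator_def)
  then have end_int: "set_integrable lborel {1} f" "(LBINT t:{1}. f t) = 0"
    by (auto simp: set_integrable_def set_lebesgue_integral_def)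
  have un: "{0..1} = {0..<1} \<union> {1::real}" by auto
  show ?thesis
    unfolding un using set_integral_Un[OF _ main(1) end_int(1)] main(2) end_int(2) by simp
qed

section \<open>The rescaled error function\<close>

text \<open>
  From here on randomness is gone: the error depends on the process only through its variogram \<open>V\<close>.
  Increments are positive because a cell is approximated from its left endpoint.
\<close>

locale sampled_variogram =
  fixes V :: "real \<Rightarrow> real \<Rightarrow> real" and \<alpha> c p :: "real \<Rightarrow> real"
    and b \<gamma> :: real and \<tau> :: "nat \<Rightarrow> nat \<Rightarrow> real"
  assumes V_cont: "\<And>s. s \<in> {0..1} \<Longrightarrow> continuous_on {0..1} (V s)"
    and V_nonneg: "\<And>s t. V s t \<ge> 0"
    and V_diag: "\<And>s. V s s = 0"
    and \<alpha>_cont: "continuous_on {0..1} \<alpha>" and c_cont: "continuous_on {0..1} c"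
    and \<alpha>_range: "\<And>t. t \<in> {0..1} \<Longrightarrow> 0 < \<alpha> t \<and> \<alpha> t \<le> 2"
    and c_pos: "\<And>t. t \<in> {0..1} \<Longrightarrow> 0 < c t"
    and V_local: "\<And>\<epsilon>. \<epsilon> > 0 \<Longrightarrow> \<exists>\<delta>>0. \<forall>t\<in>{0..1}. \<forall>s. 0 < s \<and> s < \<delta> \<and> t + s \<le> 1 \<longrightarrow>
            \<bar>V t (t + s) / s powr \<alpha> t - c t\<bar> < \<epsilon>"
    and \<alpha>_min: "\<And>t. t \<in> {0<..1} \<Longrightarrow> \<alpha> 0 < \<alpha> t"
    and b_pos: "b > 0" and \<gamma>_pos: "\<gamma> > 0"
    and \<alpha>_expansion: "(\<lambda>t. \<alpha> t - (\<alpha> 0 + b * t powr \<gamma>)) \<in> o[at_right 0](\<lambda>t. t powr \<gamma>)"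
    and density: "positive_continuous_density p"
    and design: "\<And>n. n \<ge> 1 \<Longrightarrow> regular_design p n (\<tau> n)"
begin

definition len :: "nat \<Rightarrow> nat \<Rightarrow> real" where
  "len n j = \<tau> n (Suc j) - \<tau> n j"

text \<open>
  Together with \<open>zoom n\<close> this fixes the natural scale of the problem: \<open>n powr (- \<alpha>\<^sub>0)\<close> is the size of the mean error in a
  cell near \<open>0\<close>, and \<open>1 / zoom n = (ln n) powr (- 1/\<gamma>)\<close> the width of the zone in which the errors have this
  size, because \<open>n powr \<alpha>(t)\<close> and \<open>n powr \<alpha>\<^sub>0\<close> are comparable as long as \<open>t\<^sup>\<gamma> ln n\<close> is bounded.
\<close>

definition scaled_avg :: "nat \<Rightarrow> nat \<Rightarrow> real" where
  "scaled_avg n j = real n powr \<alpha> 0 * (integral {\<tau> n j..\<tau> n (Suc j)} (V (\<tau> n j)) / len n j)"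

definition zoom :: "nat \<Rightarrow> real" where
  "zoom n = ln (real n) powr (1 / \<gamma>)"

text \<open>
  Averaging over cells leaves the total error unchanged, and stretching the cells by \<open>zoom n\<close>,
  that is, \<open>u = t \<cdot> zoom n\<close>, keeps the zone that matters at unit size as \<open>n\<close> grows.
\<close>

definition rescaled_error :: "nat \<Rightarrow> real \<Rightarrow> real" where
  "rescaled_error n u = (\<Sum>j<n. indicator {zoom n * \<tau> n j..<zoom n * \<tau> n (Suc j)} u * scaled_avg n j)"

lemma knots_sampling_design: "n \<ge> 1 \<Longrightarrow> sampling_design n (\<tau> n)"
  using design by (simp add: regular_design_def)

lemma knot_range: "j \<le> n \<Longrightarrow> n \<ge> 1 \<Longrightarrow> \<tau> n j \<in> {0..1}"
  using sampling_design_range[OF knots_sampling_design] by blast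

lemma len_pos: "j < n \<Longrightarrow> len n j > 0"
  using knots_sampling_design[of n] by (simp add: sampling_design_def len_def)

lemma density_lower_bound:
  obtains m where "m > 0" "\<And>t. t \<in> {0..1} \<Longrightarrow> m \<le> p t"
proof -
  have p: "continuous_on {0..1} p" "\<And>t. t \<in> {0..1} \<Longrightarrow> 0 < p t"
    using density by (auto simp: positive_continuous_density_def)
  obtain x where "x \<in> {0..1}" "\<And>y. y \<in> {0..1} \<Longrightarrow> p x \<le> p y"
    using continuous_attains_inf[OF _ _ p(1)] by auto
  then show ?thesis using p(2) by (intro that[of "p x"]) auto
qed

lemma cell_density:
  assumes "j < n"
  obtains \<xi> where "\<tau> n j \<le> \<xi>" "\<xi> \<le> \<tau> n (Suc j)" "\<xi> \<in> {0..1}" "real n * len n j = 1 / p \<xi>"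
proof -
  have n: "n \<ge> 1" using assms by simp
  obtain \<xi> where \<xi>: "\<tau> n j \<le> \<xi>" "\<xi> \<le> \<tau> n (Suc j)" "real n * (\<tau> n (Suc j) - \<tau> n j) * p \<xi> = 1"
    using regular_design_cell_length[OF density design[OF n] assms] by blast
  then have "p \<xi> \<noteq> 0" by auto
  moreover have "\<xi> \<in> {0..1}"
    using \<xi> knot_range[of j n] knot_range[of "Suc j" n] assms n by auto
  ultimately show ?thesis using \<xi> by (intro that[of \<xi>]) (auto simp: len_def field_simps)
qed

lemma len_le:
  obtains C where "\<And>n j. j < n \<Longrightarrow> real n * len n j \<le> C"
proof -
  obtain m where m: "m > 0" "\<And>t. t \<in> {0..1} \<Longrightarrow> m \<le> p t" using density_lower_bound by blast
  show ?thesis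
  proof (rule that[of "1 / m"])
    fix n j :: nat assume "j < n"
    then obtain \<xi> where "\<xi> \<in> {0..1}" "real n * len n j = 1 / p \<xi>" using cell_density by metis
    with m show "real n * len n j \<le> 1 / m" by (auto intro!: divide_left_mono mult_pos_pos dest: m(2) less_le_trans)
  qed
qed

lemma len_uniformly_small:
  assumes "\<delta> > 0"
  shows "\<forall>\<^sub>F n in sequentially. \<forall>j<n. len n j < \<delta>"
proof -
  obtain C where C: "\<And>n j. j < n \<Longrightarrow> real n * len n j \<le> C" using len_le by blast
  have "(\<lambda>n. C / real n) \<longlonglongrightarrow> 0" by real_asymp
  then have "\<forall>\<^sub>F n in sequentially. C / real n < \<delta>" using assms by (rule order_tendstoD(2))
  then show ?thesis
  proof eventually_elim
    case (elim n)
    show ?case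
    proof (intro allI impI)
      fix j assume j: "j < n"
      then have "len n j \<le> C / real n" using C[OF j] by (simp add: field_simps)
      with elim show "len n j < \<delta>" by simp
    qed
  qed
qed

text \<open>
  Along cells that tend to \<open>0\<close> the factors can be treated separately: the cell quotient tends to \<open>c 0 / (\<alpha> 0 + 1)\<close>, the
  normalised cell length \<open>n \<cdot> len n j\<close> to \<open>1 / p 0\<close>, and the last factor shows the loss of size
  caused by the growth of \<open>\<alpha>\<close> away from \<open>0\<close>.
\<close>

lemma scaled_avg_factorization:
  assumes "j < n"
  shows "scaled_avg n j =
    integral {\<tau> n j..\<tau> n (Suc j)} (V (\<tau> n j)) / len n j / len n j powr \<alpha> (\<tau> n j)
    * (real n * len n j) powr \<alpha> (\<tau> n j) * exp (- ((\<alpha> (\<tau> n j) - \<alpha> 0) * ln (real n)))"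
proof -
  have n: "real n > 0" using assms by simp
  have "exp (- ((\<alpha> (\<tau> n j) - \<alpha> 0) * ln (real n))) = real n powr \<alpha> 0 / real n powr \<alpha> (\<tau> n j)"
    using n by (simp add: powr_def algebra_simps flip: exp_diff)
  moreover have "(real n * len n j) powr \<alpha> (\<tau> n j) = real n powr \<alpha> (\<tau> n j) * len n j powr \<alpha> (\<tau> n j)"
    using n len_pos[OF assms] by (simp add: powr_mult)
  ultimately show ?thesis
    using n len_pos[OF assms] by (simp add: scaled_avg_def)
qed

lemma scaled_avg_nonneg: "j < n \<Longrightarrow> scaled_avg n j \<ge> 0"
  unfolding scaled_avg_def
  by (intro mult_nonneg_nonneg divide_nonneg_pos len_pos integral_nonneg
        integrable_continuous_interval continuous_on_subset[OF V_cont])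
     (use knot_range[of j n] knot_range[of "Suc j" n] V_nonneg in auto)

lemma cell_quotient_approx:
  assumes "\<epsilon> > 0"
  shows "\<forall>\<^sub>F n in sequentially. \<forall>j<n.
    \<bar>integral {\<tau> n j..\<tau> n (Suc j)} (V (\<tau> n j)) / len n j / len n j powr \<alpha> (\<tau> n j)
      - c (\<tau> n j) / (\<alpha> (\<tau> n j) + 1)\<bar> \<le> \<epsilon>"
proof -
  obtain \<delta> where \<delta>: "\<delta> > 0"
    "\<And>t h. t \<in> {0..1} \<Longrightarrow> 0 < h \<Longrightarrow> h < \<delta> \<Longrightarrow> t + h \<le> 1 \<Longrightarrow>
       \<bar>integral {t..t + h} (V t) / h / h powr \<alpha> t - c t / (\<alpha> t + 1)\<bar> \<le> \<epsilon>"
    using cell_quotient_uniform[OF V_cont V_diag conjunct1[OF \<alpha>_range] V_local assms] by blast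
  show ?thesis
    using len_uniformly_small[OF \<delta>(1)]
  proof eventually_elim
    case (elim n)
    show ?case
    proof (intro allI impI)
      fix j assume j: "j < n"
      have "\<tau> n j + len n j = \<tau> n (Suc j)" by (simp add: len_def)
      with \<delta>(2)[of "\<tau> n j" "len n j"] elim j len_pos[OF j] knot_range[of j n] knot_range[of "Suc j" n]
      show "\<bar>integral {\<tau> n j..\<tau> n (Suc j)} (V (\<tau> n j)) / len n j / len n j powr \<alpha> (\<tau> n j)
        - c (\<tau> n j) / (\<alpha> (\<tau> n j) + 1)\<bar> \<le> \<epsilon>" by auto
    qed
  qed
qed

text \<open>
  In the factorization the first two factors are bounded, uniformly in the cell, and the third one
  is controlled by the global lower bound on \<open>\<alpha> - \<alpha> 0\<close>.
\<close>

lemma scaled_avg_bound: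
  obtains K \<beta> where "K > 0" "\<beta> > 0"
    "\<forall>\<^sub>F n in sequentially. \<forall>j<n. scaled_avg n j \<le> K * exp (- (\<beta> * \<tau> n j powr \<gamma> * ln (real n)))"
proof -
  obtain \<beta> where \<beta>: "\<beta> > 0" "\<And>t. t \<in> {0..1} \<Longrightarrow> \<alpha> 0 + \<beta> * t powr \<gamma> \<le> \<alpha> t"
    using exponent_lower_bound[OF \<alpha>_cont \<alpha>_min b_pos \<gamma>_pos \<alpha>_expansion] by blast
  obtain x where x: "x \<in> {0..1}" "\<And>y. y \<in> {0..1} \<Longrightarrow> c y \<le> c x"
    using continuous_attains_sup[OF _ _ c_cont] by auto
  obtain C where C: "\<And>n j. j < n \<Longrightarrow> real n * len n j \<le> C" using len_le by blast
  define K where "K = (c x + 1) * (max 1 C)\<^sup>2"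
  have "K > 0" using c_pos[OF x(1)] by (auto simp: K_def intro!: mult_pos_pos)
  moreover have "\<forall>\<^sub>F n in sequentially. \<forall>j<n. scaled_avg n j \<le> K * exp (- (\<beta> * \<tau> n j powr \<gamma> * ln (real n)))"
    using cell_quotient_approx[OF zero_less_one]
  proof eventually_elim
    case (elim n)
    show ?case
    proof (intro allI impI)
      fix j assume j: "j < n"
      define t where "t = \<tau> n j"
      have t: "t \<in> {0..1}" using knot_range j by (simp add: t_def)
      let ?Q = "integral {\<tau> n j..\<tau> n (Suc j)} (V (\<tau> n j)) / len n j / len n j powr \<alpha> (\<tau> n j)"
      have "c t / (\<alpha> t + 1) \<le> c t"
        using \<alpha>_range[OF t] c_pos[OF t] by (simp add: divide_le_eq)
      moreover have "\<bar>?Q - c t / (\<alpha> t + 1)\<bar> \<le> 1" using elim j by (simp add: t_def)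
      ultimately have Q: "?Q \<le> c x + 1" using x(2)[OF t] by linarith
      have Q0: "0 \<le> ?Q"
        by (intro divide_nonneg_nonneg integral_nonneg less_imp_le[OF len_pos[OF j]]
              integrable_continuous_interval continuous_on_subset[OF V_cont])
           (use knot_range[of j n] knot_range[of "Suc j" n] V_nonneg j in auto)
      have "(real n * len n j) powr \<alpha> t \<le> (max 1 C) powr \<alpha> t"
        using C[OF j] \<alpha>_range[OF t] len_pos[OF j] by (intro powr_mono2) auto
      also have "\<dots> \<le> (max 1 C) powr 2"
        using \<alpha>_range[OF t] by (intro powr_mono) auto
      finally have R: "(real n * len n j) powr \<alpha> t \<le> (max 1 C)\<^sup>2"
        by (simp add: powr_numeral)
      have "\<beta> * t powr \<gamma> * ln (real n) \<le> (\<alpha> t - \<alpha> 0) * ln (real n)"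
        using \<beta>(2)[OF t] j by (intro mult_right_mono) auto
      then have E: "exp (- ((\<alpha> t - \<alpha> 0) * ln (real n))) \<le> exp (- (\<beta> * t powr \<gamma> * ln (real n)))"
        by simp
      show "scaled_avg n j \<le> K * exp (- (\<beta> * \<tau> n j powr \<gamma> * ln (real n)))"
        unfolding scaled_avg_factorization[OF j] K_def
        using Q Q0 R E c_pos[OF x(1)] unfolding t_def by (intro mult_mono) auto
    qed
  qed
  ultimately show ?thesis using \<beta>(1) that by blast
qed

lemma zoom_nonneg: "zoom n \<ge> 0"
  by (simp add: zoom_def)

lemma zoom_powr: "n \<ge> 1 \<Longrightarrow> zoom n powr \<gamma> = ln (real n)"
  using \<gamma>_pos by (simp add: zoom_def powr_powr)

lemma zoom_at_top: "filterlim zoom at_top sequentially"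
  unfolding zoom_def using \<gamma>_pos by real_asymp

lemma zoom_div_n: "(\<lambda>n. zoom n * (C / real n)) \<longlonglongrightarrow> 0"
  unfolding zoom_def using \<gamma>_pos by real_asymp

section \<open>Pointwise limit\<close>

text \<open>
  Cells whose left endpoints tend to \<open>0\<close> shrink to \<open>0\<close>, and the mean value points in them follow.
\<close>

lemma knot_density_limit:
  assumes j: "\<And>n. n \<ge> N \<Longrightarrow> j n < n"
    and T: "(\<lambda>n. \<tau> n (j n)) \<longlonglongrightarrow> 0"
  shows "(\<lambda>n. real n * len n (j n)) \<longlonglongrightarrow> 1 / p 0"
proof -
  have "\<exists>\<xi>. n \<ge> N \<longrightarrow> \<tau> n (j n) \<le> \<xi> \<and> \<xi> \<le> \<tau> n (Suc (j n)) \<and> \<xi> \<in> {0..1} \<and> real n * len n (j n) = 1 / p \<xi>" for n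
    using cell_density[OF j[of n]] by metis
  then obtain \<xi> where \<xi>: "\<And>n. n \<ge> N \<Longrightarrow> \<tau> n (j n) \<le> \<xi> n \<and> \<xi> n \<le> \<tau> n (Suc (j n)) \<and>
      \<xi> n \<in> {0..1} \<and> real n * len n (j n) = 1 / p (\<xi> n)"
    by metis
  have len0: "(\<lambda>n. len n (j n)) \<longlonglongrightarrow> 0"
    unfolding tendsto_iff
  proof (intro allI impI)
    fix e :: real assume "e > 0"
    from len_uniformly_small[OF this] eventually_ge_at_top[of N]
    show "\<forall>\<^sub>F n in sequentially. dist (len n (j n)) 0 < e"
      by eventually_elim (use j len_pos in \<open>auto simp: dist_real_def abs_of_pos\<close>)
  qed
  have "(\<lambda>n. \<tau> n (j n) + len n (j n)) \<longlonglongrightarrow> 0"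
    using tendsto_add[OF T len0] by simp
  then have "\<xi> \<longlonglongrightarrow> 0"
  proof (rule tendsto_sandwich[OF _ _ T, rotated 2])
    show "\<forall>\<^sub>F n in sequentially. \<tau> n (j n) \<le> \<xi> n"
      using eventually_ge_at_top[of N] by eventually_elim (use \<xi> in blast)
    show "\<forall>\<^sub>F n in sequentially. \<xi> n \<le> \<tau> n (j n) + len n (j n)"
      using eventually_ge_at_top[of N] by eventually_elim (use \<xi> in \<open>simp add: len_def\<close>)
  qed
  moreover have "\<forall>\<^sub>F n in sequentially. \<xi> n \<in> {0..1}"
    using \<xi> by (auto simp: eventually_sequentially)
  moreover have "continuous_on {0..1} p" "p 0 > 0"
    using density by (auto simp: positive_continuous_density_def)
  ultimately have "(\<lambda>n. 1 / p (\<xi> n)) \<longlonglongrightarrow> 1 / p 0"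
    by (intro tendsto_divide tendsto_const continuous_on_tendsto_compose[of "{0..1}" p]) auto
  then show ?thesis
  proof (rule Lim_transform_eventually)
    show "\<forall>\<^sub>F n in sequentially. 1 / p (\<xi> n) = real n * len n (j n)"
      using eventually_ge_at_top[of N] by eventually_elim (use \<xi> in simp)
  qed
qed

text \<open>
  Since \<open>(zoom n)\<^sup>\<gamma> = ln n\<close>, the left-hand side is \<open>\<rho>(T n) (zoom n \<cdot> T n)\<^sup>\<gamma>\<close> with
  \<open>\<rho>(t) = (\<alpha> t - \<alpha> 0) / t\<^sup>\<gamma>\<close>, and the expansion of \<open>\<alpha>\<close> says that \<open>\<rho> \<rightarrow> b\<close> at \<open>0\<close>.
\<close>

lemma exponent_growth_limit:
  assumes T: "T \<longlonglongrightarrow> 0" "\<And>n. n \<ge> N \<Longrightarrow> T n \<in> {0..1}"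
    and u: "(\<lambda>n. zoom n * T n) \<longlonglongrightarrow> u" "u \<ge> 0"
  shows "(\<lambda>n. (\<alpha> (T n) - \<alpha> 0) * ln (real n)) \<longlonglongrightarrow> b * u powr \<gamma>"
proof -
  \<comment> \<open>The first cell has left endpoint 0, so the value b at 0 has to make this continuous.\<close>
  define \<rho> where "\<rho> = (\<lambda>t. if t = 0 then b else (\<alpha> t - \<alpha> 0) / t powr \<gamma>)"
  have \<rho>: "(\<lambda>n. \<rho> (T n)) \<longlonglongrightarrow> b"
    unfolding tendsto_iff
  proof (intro allI impI)
    fix e :: real assume e: "e > 0"
    have "eventually (\<lambda>t. norm (\<alpha> t - (\<alpha> 0 + b * t powr \<gamma>)) \<le> e / 2 * norm (t powr \<gamma>)) (at_right 0)"
      using landau_o.smallD[OF \<alpha>_expansion, of "e / 2"] e by simp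
    then obtain \<delta> where \<delta>: "\<delta> > 0"
      "\<And>t. 0 < t \<Longrightarrow> t < \<delta> \<Longrightarrow> \<bar>\<alpha> t - (\<alpha> 0 + b * t powr \<gamma>)\<bar> \<le> e / 2 * t powr \<gamma>"
      unfolding eventually_at_right_field by auto
    have close: "dist (\<rho> t) b < e" if t: "0 \<le> t" "t < \<delta>" for t
    proof (cases "t = 0")
      case False
      then have tp: "t > 0" "t powr \<gamma> > 0" using t by auto
      have "\<rho> t - b = (\<alpha> t - (\<alpha> 0 + b * t powr \<gamma>)) / t powr \<gamma>"
        using False tp by (simp add: \<rho>_def field_simps)
      then have "\<bar>\<rho> t - b\<bar> = \<bar>\<alpha> t - (\<alpha> 0 + b * t powr \<gamma>)\<bar> / t powr \<gamma>"
        using tp by (simp add: abs_divide)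
      also have "\<dots> \<le> e / 2"
        using \<delta>(2)[of t] t tp by (simp add: divide_le_eq)
      finally show ?thesis using e by (simp add: dist_real_def)
    qed (use e in \<open>simp add: \<rho>_def\<close>)
    have "\<forall>\<^sub>F n in sequentially. T n < \<delta>"
      using T(1) \<delta>(1) by (rule order_tendstoD(2))
    with eventually_ge_at_top[of N] show "\<forall>\<^sub>F n in sequentially. dist (\<rho> (T n)) b < e"
      by eventually_elim (use T(2) close in auto)
  qed
  have "\<forall>\<^sub>F n in sequentially. 0 \<le> zoom n * T n"
    using eventually_ge_at_top[of N] by eventually_elim (use T(2) zoom_nonneg in auto)
  then have "(\<lambda>n. \<rho> (T n) * (zoom n * T n) powr \<gamma>) \<longlonglongrightarrow> b * u powr \<gamma>"
    using \<gamma>_pos by (intro tendsto_intros tendsto_powr' \<rho> u(1)) auto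
  then show ?thesis
  proof (rule Lim_transform_eventually)
    show "\<forall>\<^sub>F n in sequentially. \<rho> (T n) * (zoom n * T n) powr \<gamma> = (\<alpha> (T n) - \<alpha> 0) * ln (real n)"
      using eventually_ge_at_top[of N] eventually_ge_at_top[of 1]
    proof eventually_elim
      case (elim n)
      have "(zoom n * T n) powr \<gamma> = ln (real n) * T n powr \<gamma>"
        using zoom_powr[of n] zoom_nonneg[of n] T(2)[of n] elim by (simp add: powr_mult)
      then show ?case by (auto simp: \<rho>_def)
    qed
  qed
qed

lemma scaled_avg_limit:
  assumes j: "\<And>n. n \<ge> N \<Longrightarrow> j n < n"
    and u: "(\<lambda>n. zoom n * \<tau> n (j n)) \<longlonglongrightarrow> u" "u \<ge> 0"
  shows "(\<lambda>n. scaled_avg n (j n)) \<longlonglongrightarrow>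
           c 0 / (\<alpha> 0 + 1) / p 0 powr \<alpha> 0 * exp (- (b * u powr \<gamma>))"
proof -
  define T where "T = (\<lambda>n. \<tau> n (j n))"
  have Tr: "T n \<in> {0..1}" if "n \<ge> N" for n
    using knot_range[of "j n" n] j[OF that] by (simp add: T_def)
  have "(\<lambda>n. zoom n * T n / zoom n) \<longlonglongrightarrow> 0"
    using u(1) zoom_at_top unfolding T_def
    by (rule tendsto_divide_0[OF _ filterlim_at_top_imp_at_infinity])
  moreover have "\<forall>\<^sub>F n in sequentially. zoom n > 0"
    using zoom_at_top by (simp add: filterlim_at_top_dense)
  then have "\<forall>\<^sub>F n in sequentially. zoom n * T n / zoom n = T n"
    by eventually_elim simp
  ultimately have T0: "T \<longlonglongrightarrow> 0" by (rule Lim_transform_eventually)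
  have Tev: "\<forall>\<^sub>F n in sequentially. T n \<in> {0..1}"
    using Tr by (auto simp: eventually_sequentially)
  have uT: "(\<lambda>n. zoom n * T n) \<longlonglongrightarrow> u" using u(1) by (simp add: T_def)
  have \<alpha>T: "(\<lambda>n. \<alpha> (T n)) \<longlonglongrightarrow> \<alpha> 0"
    by (rule continuous_on_tendsto_compose[OF \<alpha>_cont T0 _ Tev]) simp
  have cT: "(\<lambda>n. c (T n)) \<longlonglongrightarrow> c 0"
    by (rule continuous_on_tendsto_compose[OF c_cont T0 _ Tev]) simp
  have \<alpha>0: "\<alpha> 0 > 0" using \<alpha>_range[of 0] by simp
  define Q where "Q = (\<lambda>n. integral {T n..\<tau> n (Suc (j n))} (V (T n)) / len n (j n) / len n (j n) powr \<alpha> (T n))"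
  have "(\<lambda>n. Q n - c (T n) / (\<alpha> (T n) + 1)) \<longlonglongrightarrow> 0"
    unfolding tendsto_iff
  proof (intro allI impI)
    fix e :: real assume "e > 0"
    then have "e / 2 > 0" by simp
    from cell_quotient_approx[OF this] eventually_ge_at_top[of N]
    show "\<forall>\<^sub>F n in sequentially. dist (Q n - c (T n) / (\<alpha> (T n) + 1)) 0 < e"
    proof eventually_elim
      case (elim n)
      with j have "\<bar>Q n - c (T n) / (\<alpha> (T n) + 1)\<bar> \<le> e / 2" by (auto simp: Q_def T_def)
      with \<open>e > 0\<close> show ?case by (simp add: dist_real_def)
    qed
  qed
  moreover have "(\<lambda>n. c (T n) / (\<alpha> (T n) + 1)) \<longlonglongrightarrow> c 0 / (\<alpha> 0 + 1)"
    using \<alpha>0 by (intro tendsto_intros cT \<alpha>T) auto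
  ultimately have Q: "Q \<longlonglongrightarrow> c 0 / (\<alpha> 0 + 1)"
    using tendsto_add by fastforce
  have p0: "p 0 > 0" using density by (simp add: positive_continuous_density_def)
  have R: "(\<lambda>n. (real n * len n (j n)) powr \<alpha> (T n)) \<longlonglongrightarrow> (1 / p 0) powr \<alpha> 0"
    using p0 knot_density_limit[OF j T0[unfolded T_def]] by (intro tendsto_powr \<alpha>T) auto
  have "(\<lambda>n. Q n * (real n * len n (j n)) powr \<alpha> (T n) * exp (- ((\<alpha> (T n) - \<alpha> 0) * ln (real n))))
     \<longlonglongrightarrow> c 0 / (\<alpha> 0 + 1) * (1 / p 0) powr \<alpha> 0 * exp (- (b * u powr \<gamma>))"
    by (intro tendsto_intros Q R exponent_growth_limit[OF T0 Tr uT u(2)])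
  moreover have "\<forall>\<^sub>F n in sequentially. Q n * (real n * len n (j n)) powr \<alpha> (T n) * exp (- ((\<alpha> (T n) - \<alpha> 0) * ln (real n)))
      = scaled_avg n (j n)"
    using eventually_ge_at_top[of N]
    by eventually_elim (simp only: Q_def T_def scaled_avg_factorization[OF j])
  ultimately have "(\<lambda>n. scaled_avg n (j n)) \<longlonglongrightarrow> c 0 / (\<alpha> 0 + 1) * (1 / p 0) powr \<alpha> 0 * exp (- (b * u powr \<gamma>))"
    by (rule Lim_transform_eventually)
  then show ?thesis using p0 by (simp add: powr_divide)
qed

lemma rescaled_error_cell:
  assumes "i < n" "zoom n * \<tau> n i \<le> u" "u < zoom n * \<tau> n (Suc i)"
  shows "rescaled_error n u = scaled_avg n i"
proof -
  have n: "n \<ge> 1" using assms(1) by simp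
  have z: "zoom n > 0"
    using assms zoom_nonneg[of n] by (cases "zoom n = 0") auto
  have "indicator {zoom n * \<tau> n j..<zoom n * \<tau> n (Suc j)} u * scaled_avg n j
      = (if j = i then scaled_avg n i else 0)" if "j < n" for j
  proof (cases "j = i")
    case True
    then show ?thesis using assms by simp
  next
    case False
    have "\<tau> n i \<le> u / zoom n" "u / zoom n < \<tau> n (Suc i)"
      using assms z by (simp_all add: pos_le_divide_eq pos_divide_less_eq mult.commute)
    then have "\<not> (\<tau> n j \<le> u / zoom n \<and> u / zoom n < \<tau> n (Suc j))"
      using sampling_design_cell_unique[OF knots_sampling_design[OF n] assms(1) that] False by blast
    then have "u \<notin> {zoom n * \<tau> n j..<zoom n * \<tau> n (Suc j)}"
      using z by (simp add: pos_le_divide_eq pos_divide_less_eq mult.commute)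
    then show ?thesis using False by simp
  qed
  then show ?thesis
    using assms(1) by (simp add: rescaled_error_def sum.delta')
qed

lemma rescaled_error_outside:
  assumes "\<And>i. i < n \<Longrightarrow> zoom n * \<tau> n i \<le> u \<Longrightarrow> u < zoom n * \<tau> n (Suc i) \<Longrightarrow> False"
  shows "rescaled_error n u = 0"
  unfolding rescaled_error_def using assms by (intro sum.neutral) (auto simp: indicator_def)

text \<open>
  For \<open>u \<ge> 0\<close> the cell around \<open>u / zoom n\<close> has a length of order \<open>1 / n\<close>, which is negligible even
  after magnification by \<open>zoom n\<close>; hence its magnified left endpoint tends to \<open>u\<close>.
\<close>

lemma rescaled_error_limit:
  "(\<lambda>n. rescaled_error n u) \<longlonglongrightarrow>
     indicator {0..} u * (c 0 / (\<alpha> 0 + 1) / p 0 powr \<alpha> 0 * exp (- (b * u powr \<gamma>)))"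
proof (cases "u \<ge> 0")
  case False
  have "rescaled_error n u = 0" for n
  proof (rule rescaled_error_outside)
    fix i assume "i < n" "zoom n * \<tau> n i \<le> u"
    moreover have "0 \<le> zoom n * \<tau> n i"
      using knot_range[of i n] \<open>i < n\<close> by (intro mult_nonneg_nonneg zoom_nonneg) auto
    ultimately show False using False by linarith
  qed
  with False show ?thesis by simp
next
  case True
  obtain N where N: "N \<ge> 1" "\<And>n. n \<ge> N \<Longrightarrow> u < zoom n"
  proof -
    have "\<forall>\<^sub>F n in sequentially. u < zoom n"
      using zoom_at_top by (simp add: filterlim_at_top_dense)
    then obtain N where "\<And>n. n \<ge> N \<Longrightarrow> u < zoom n" by (auto simp: eventually_sequentially)
    then show ?thesis by (intro that[of "max 1 N"]) auto
  qed
  have "\<exists>i. n \<ge> N \<longrightarrow> i < n \<and> zoom n * \<tau> n i \<le> u \<and> u < zoom n * \<tau> n (Suc i)" for n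
  proof (cases "n \<ge> N")
    case n: True
    then have z: "u < zoom n" "n \<ge> 1" using N by auto
    then obtain i where "i < n" "\<tau> n i \<le> u / zoom n" "u / zoom n < \<tau> n (Suc i)"
      using sampling_design_cell_exists[OF knots_sampling_design, of n "u / zoom n"] True by auto
    then show ?thesis using z True by (intro exI[of _ i]) (auto simp: field_simps)
  qed auto
  then obtain j where j: "\<And>n. n \<ge> N \<Longrightarrow> j n < n \<and> zoom n * \<tau> n (j n) \<le> u \<and> u < zoom n * \<tau> n (Suc (j n))"
    by metis
  obtain C where C: "\<And>n j. j < n \<Longrightarrow> real n * len n j \<le> C" using len_le by blast
  have lower: "u - zoom n * (C / real n) \<le> zoom n * \<tau> n (j n)" if "n \<ge> N" for n
  proof -
    have "len n (j n) \<le> C / real n"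
      using C[of "j n" n] j[OF that] by (auto simp: field_simps)
    then have "zoom n * len n (j n) \<le> zoom n * (C / real n)"
      by (rule mult_left_mono[OF _ zoom_nonneg])
    with j[OF that] show ?thesis by (auto simp: len_def algebra_simps)
  qed
  have "(\<lambda>n. u - zoom n * (C / real n)) \<longlonglongrightarrow> u"
    using tendsto_diff[OF tendsto_const zoom_div_n, of u C] by simp
  then have "(\<lambda>n. zoom n * \<tau> n (j n)) \<longlonglongrightarrow> u"
  proof (rule tendsto_sandwich[rotated 2])
    show "\<forall>\<^sub>F n in sequentially. u - zoom n * (C / real n) \<le> zoom n * \<tau> n (j n)"
      using eventually_ge_at_top[of N] by eventually_elim (use lower in blast)
    show "\<forall>\<^sub>F n in sequentially. zoom n * \<tau> n (j n) \<le> u"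
      using eventually_ge_at_top[of N] by eventually_elim (use j in blast)
  qed simp_all
  from scaled_avg_limit[OF _ this True, of N] j
  have "(\<lambda>n. scaled_avg n (j n)) \<longlonglongrightarrow> c 0 / (\<alpha> 0 + 1) / p 0 powr \<alpha> 0 * exp (- (b * u powr \<gamma>))"
    by blast
  moreover have "\<forall>\<^sub>F n in sequentially. scaled_avg n (j n) = rescaled_error n u"
    using eventually_ge_at_top[of N]
  proof eventually_elim
    case (elim n)
    with j[of n] show ?case by (intro rescaled_error_cell[symmetric]) auto
  qed
  ultimately show ?thesis
    using True by (auto intro: Lim_transform_eventually)
qed

section \<open>Domination and passage to the limit\<close>

text \<open>
  The bound on \<open>scaled_avg\<close> is expressed through the magnified left endpoint \<open>w\<close> of the cell, and
  \<open>u < w + 1\<close> once all magnified cells are shorter than \<open>1\<close>. To get one integrable function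
  of \<open>u\<close>, the shift is absorbed by \<open>(u / 2)\<^sup>\<gamma> \<le> 1 + w\<^sup>\<gamma>\<close>: if \<open>u \<le> 2\<close> the left side is at most \<open>1\<close>, and
  otherwise \<open>w \<ge> u / 2\<close>.
\<close>

lemma rescaled_error_dominated:
  obtains K \<beta> where "\<beta> > 0"
    "\<forall>\<^sub>F n in sequentially. \<forall>u. \<bar>rescaled_error n u\<bar> \<le> K * (indicator {0..} u * exp (- (\<beta> * u powr \<gamma>)))"
proof -
  obtain K \<beta> where K: "K > 0" "\<beta> > 0"
    "\<forall>\<^sub>F n in sequentially. \<forall>j<n. scaled_avg n j \<le> K * exp (- (\<beta> * \<tau> n j powr \<gamma> * ln (real n)))"
    using scaled_avg_bound by blast
  obtain C where C: "\<And>n j. j < n \<Longrightarrow> real n * len n j \<le> C" using len_le by blast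
  have "\<forall>\<^sub>F n in sequentially. zoom n * (C / real n) < 1"
    using zoom_div_n[of C] by (rule order_tendstoD(2)) simp
  then have "\<forall>\<^sub>F n in sequentially. \<forall>u. \<bar>rescaled_error n u\<bar>
      \<le> (K * exp \<beta>) * (indicator {0..} u * exp (- (\<beta> / 2 powr \<gamma> * u powr \<gamma>)))"
    using K(3)
  proof eventually_elim
    case (elim n)
    show ?case
    proof
      fix u
      show "\<bar>rescaled_error n u\<bar> \<le> (K * exp \<beta>) * (indicator {0..} u * exp (- (\<beta> / 2 powr \<gamma> * u powr \<gamma>)))"
      proof (cases "\<exists>i<n. zoom n * \<tau> n i \<le> u \<and> u < zoom n * \<tau> n (Suc i)")
        case False
        then have "rescaled_error n u = 0" by (intro rescaled_error_outside) auto
        then show ?thesis using K(1) by simp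
      next
        case True
        then obtain i where i: "i < n" "zoom n * \<tau> n i \<le> u" "u < zoom n * \<tau> n (Suc i)" by blast
        define w where "w = zoom n * \<tau> n i"
        have t: "\<tau> n i \<ge> 0" using knot_range[of i n] i by auto
        then have w: "w \<ge> 0" using zoom_nonneg by (simp add: w_def)
        have u: "u \<ge> 0" using w i by (simp add: w_def)
        have "len n i \<le> C / real n" using C[OF i(1)] i by (simp add: field_simps)
        then have "zoom n * len n i \<le> zoom n * (C / real n)"
          by (rule mult_left_mono[OF _ zoom_nonneg])
        moreover have "zoom n * \<tau> n (Suc i) = w + zoom n * len n i"
          by (simp add: w_def len_def algebra_simps)
        ultimately have uw: "u \<le> w + 1" using i elim(1) by linarith
        have "(u / 2) powr \<gamma> \<le> 1 + w powr \<gamma>"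
        proof (cases "u \<le> 2")
          case True
          then have "(u / 2) powr \<gamma> \<le> 1" using u \<gamma>_pos powr_mono2[of \<gamma> "u / 2" 1] by simp
          then show ?thesis by (simp add: add_increasing2)
        next
          case False
          then have "(u / 2) powr \<gamma> \<le> w powr \<gamma>" using uw \<gamma>_pos by (intro powr_mono2) auto
          then show ?thesis by simp
        qed
        then have "\<beta> * ((u / 2) powr \<gamma>) \<le> \<beta> * (1 + w powr \<gamma>)"
          using K(2) by (intro mult_left_mono) auto
        moreover have "\<beta> * ((u / 2) powr \<gamma>) = \<beta> / 2 powr \<gamma> * u powr \<gamma>"
          using u by (simp add: powr_divide)
        ultimately have ex: "- (\<beta> * w powr \<gamma>) \<le> \<beta> + - (\<beta> / 2 powr \<gamma> * u powr \<gamma>)"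
          by (simp add: algebra_simps)
        have "\<tau> n i powr \<gamma> * ln (real n) = w powr \<gamma>"
          using zoom_powr[of n] zoom_nonneg[of n] t i by (simp add: w_def powr_mult)
        then have "scaled_avg n i \<le> K * exp (- (\<beta> * w powr \<gamma>))"
          using elim(2) i(1) by (metis mult.assoc)
        also have "\<dots> \<le> K * exp (\<beta> + - (\<beta> / 2 powr \<gamma> * u powr \<gamma>))"
          using K(1) ex by simp
        finally show ?thesis
          using scaled_avg_nonneg[OF i(1)] u
          unfolding rescaled_error_cell[OF i] exp_add by (simp add: mult.assoc)
      qed
    qed
  qed
  then show ?thesis using K(2) that[of "\<beta> / 2 powr \<gamma>" "K * exp \<beta>"] by simp
qed

lemma rescaled_error_measurable [measurable]: "rescaled_error n \<in> borel_measurable borel"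
  unfolding rescaled_error_def[abs_def] by measurable

lemma rescaled_error_integral:
  "integral\<^sup>L lborel (rescaled_error n)
     = real n powr \<alpha> 0 * zoom n * (\<Sum>j<n. integral {\<tau> n j..\<tau> n (Suc j)} (V (\<tau> n j)))"
proof -
  have cell: "has_bochner_integral lborel
      (\<lambda>u. indicator {zoom n * \<tau> n j..<zoom n * \<tau> n (Suc j)} u * scaled_avg n j)
      (zoom n * len n j * scaled_avg n j)" if "j < n" for j
  proof -
    have le: "zoom n * \<tau> n j \<le> zoom n * \<tau> n (Suc j)"
      using zoom_nonneg len_pos[OF that] by (intro mult_left_mono) (auto simp: len_def)
    have "has_bochner_integral lborel (indicator {zoom n * \<tau> n j..<zoom n * \<tau> n (Suc j)})
       (measure lborel {zoom n * \<tau> n j..<zoom n * \<tau> n (Suc j)})"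
      using le by (intro has_bochner_integral_real_indicator) auto
    then have "has_bochner_integral lborel (indicator {zoom n * \<tau> n j..<zoom n * \<tau> n (Suc j)}) (zoom n * len n j)"
      using le by (simp add: len_def right_diff_distrib)
    then show ?thesis by (rule has_bochner_integral_mult_left)
  qed
  have "has_bochner_integral lborel (rescaled_error n) (\<Sum>j<n. zoom n * len n j * scaled_avg n j)"
    unfolding rescaled_error_def[abs_def] using cell by (intro has_bochner_integral_sum) auto
  then have "integral\<^sup>L lborel (rescaled_error n) = (\<Sum>j<n. zoom n * len n j * scaled_avg n j)"
    by (rule has_bochner_integral_integral_eq)
  also have "\<dots> = (\<Sum>j<n. real n powr \<alpha> 0 * zoom n * integral {\<tau> n j..\<tau> n (Suc j)} (V (\<tau> n j)))"
  proof (rule sum.cong[OF refl])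
    fix j assume "j \<in> {..<n}"
    then have "len n j \<noteq> 0" using len_pos[of j n] by auto
    then show "zoom n * len n j * scaled_avg n j
        = real n powr \<alpha> 0 * zoom n * integral {\<tau> n j..\<tau> n (Suc j)} (V (\<tau> n j))"
      by (simp add: scaled_avg_def)
  qed
  finally show ?thesis by (simp add: sum_distrib_left)
qed

text \<open>
  Up to the factor \<open>c 0 / (\<alpha> 0 + 1) / p 0 powr \<alpha> 0\<close> the limit function of the rescaled errors is
  the stretched exponential, so the limit of their integrals is this factor times the Gamma integral.
\<close>

theorem cell_sum_limit:
  "(\<lambda>n. real n powr \<alpha> 0 * zoom n * (\<Sum>j<n. integral {\<tau> n j..\<tau> n (Suc j)} (V (\<tau> n j))))
     \<longlonglongrightarrow> c 0 / (\<alpha> 0 + 1) * (Gamma (1 / \<gamma> + 1) / (p 0 powr \<alpha> 0 * b powr (1 / \<gamma>)))"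
proof -
  define A where "A = c 0 / (\<alpha> 0 + 1) / p 0 powr \<alpha> 0"
  define F where "F = (\<lambda>u. indicator {0..} u * (A * exp (- (b * u powr \<gamma>))))"
  obtain K \<beta> where K: "\<beta> > 0" and
    "\<forall>\<^sub>F n in sequentially. \<forall>u. \<bar>rescaled_error n u\<bar> \<le> K * (indicator {0..} u * exp (- (\<beta> * u powr \<gamma>)))"
    using rescaled_error_dominated by blast
  then obtain N where N: "\<And>n u. n \<ge> N \<Longrightarrow>
      \<bar>rescaled_error n u\<bar> \<le> K * (indicator {0..} u * exp (- (\<beta> * u powr \<gamma>)))"
    by (auto simp: eventually_sequentially)
  \<comment> \<open>The domination holds only from N on, hence the shift of the index.\<close>
  have "(\<lambda>n. integral\<^sup>L lborel (rescaled_error (n + N))) \<longlonglongrightarrow> integral\<^sup>L lborel F"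
  proof (rule integral_dominated_convergence)
    show "F \<in> borel_measurable lborel" unfolding F_def by measurable
    show "integrable lborel (\<lambda>u. K * (indicator {0..} u * exp (- (\<beta> * u powr \<gamma>))))"
      using stretched_exponential_has_bochner_integral[OF K \<gamma>_pos]
      by (intro integrable_mult_right) (rule has_bochner_integral_iff[THEN iffD1, THEN conjunct1])
    show "AE u in lborel. (\<lambda>n. rescaled_error (n + N) u) \<longlonglongrightarrow> F u"
      unfolding F_def A_def by (intro AE_I2 LIMSEQ_ignore_initial_segment rescaled_error_limit)
    show "AE u in lborel. norm (rescaled_error (n + N) u) \<le> K * (indicator {0..} u * exp (- (\<beta> * u powr \<gamma>)))" for n
      using N[of "n + N"] by simp
  qed simp
  then have "(\<lambda>n. integral\<^sup>L lborel (rescaled_error n)) \<longlonglongrightarrow> integral\<^sup>L lborel F"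
    by (rule LIMSEQ_offset)
  moreover have "has_bochner_integral lborel F (A * (Gamma (1 / \<gamma> + 1) / b powr (1 / \<gamma>)))"
    using has_bochner_integral_mult_right[OF stretched_exponential_has_bochner_integral[OF b_pos \<gamma>_pos], of A]
    by (simp add: F_def mult.left_commute)
  then have "integral\<^sup>L lborel F = c 0 / (\<alpha> 0 + 1) * (Gamma (1 / \<gamma> + 1) / (p 0 powr \<alpha> 0 * b powr (1 / \<gamma>)))"
    by (simp add: has_bochner_integral_integral_eq A_def)
  ultimately show ?thesis by (simp add: rescaled_error_integral)
qed

end

section \<open>The mean-square approximation error\<close>

theorem theorem2:
  fixes M :: "'a measure"
    and X :: "real \<Rightarrow> 'a \<Rightarrow> real"
    and \<alpha> c p :: "real \<Rightarrow> real"
    and b \<gamma> :: real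
    and \<tau> :: "nat \<Rightarrow> nat \<Rightarrow> real"
    and Xn :: "nat \<Rightarrow> real \<Rightarrow> 'a \<Rightarrow> real"
  assumes stat: "locally_stationary M \<alpha> c X"
    and C1: "\<And>t. is_arg_min \<alpha> (\<lambda>s. s \<in> {0..1}) t \<longleftrightarrow> t = 0"
    and C2: "b > 0" "\<gamma> > 0"
      "(\<lambda>t. \<alpha> t - (\<alpha> 0 + b * t powr \<gamma>)) \<in> o[at_right 0](\<lambda>t. t powr \<gamma>)"
    and dens: "positive_continuous_density p"
    and design: "\<And>n. n \<ge> 1 \<Longrightarrow> regular_design p n (\<tau> n)"
    and approx: "\<And>n. n \<ge> 1 \<Longrightarrow> piecewise_constant_approx X n (\<tau> n) (Xn n)"
  shows "(\<lambda>n. LBINT t:{0..1}. (\<integral>\<omega>. (X t \<omega> - Xn n t \<omega>)\<^sup>2 \<partial>M))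
      \<sim>[sequentially]
    (\<lambda>n. (c 0 / (\<alpha> 0 + 1) * (Gamma (1 / \<gamma> + 1) / (p 0 powr \<alpha> 0 * b powr (1 / \<gamma>))))
         / (real n powr \<alpha> 0 * ln (real n) powr (1 / \<gamma>)))"
proof -
  have \<alpha>_strict_min: "\<alpha> 0 < \<alpha> t" if t: "t \<in> {0<..1}" for t
  proof (rule ccontr)
    assume "\<not> \<alpha> 0 < \<alpha> t"
    moreover have "is_arg_min \<alpha> (\<lambda>s. s \<in> {0..1}) 0" using C1 by blast
    ultimately have "is_arg_min \<alpha> (\<lambda>s. s \<in> {0..1}) t"
      using t by (force simp: is_arg_min_def)
    with C1 t show False by auto
  qed
  interpret sampled_variogram "variogram M X" \<alpha> c p b \<gamma> \<tau>
  proof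
    show "\<exists>\<delta>>0. \<forall>t\<in>{0..1}. \<forall>s. 0 < s \<and> s < \<delta> \<and> t + s \<le> 1 \<longrightarrow>
        \<bar>variogram M X t (t + s) / s powr \<alpha> t - c t\<bar> < \<epsilon>" if \<epsilon>: "\<epsilon> > 0" for \<epsilon>
    proof -
      obtain \<delta> where \<delta>: "\<delta> > 0"
        "\<And>s t. t \<in> {0..1} \<Longrightarrow> t + s \<in> {0..1} \<Longrightarrow> s \<noteq> 0 \<Longrightarrow> \<bar>s\<bar> < \<delta> \<Longrightarrow>
           \<bar>variogram M X t (t + s) / \<bar>s\<bar> powr \<alpha> t - c t\<bar> < \<epsilon>"
        using locally_stationary_variogram[OF stat \<epsilon>] by blast
      show ?thesis
      proof (intro exI[of _ \<delta>] conjI ballI allI impI \<delta>(1); elim conjE)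
        fix t s :: real assume "t \<in> {0..1}" "0 < s" "s < \<delta>" "t + s \<le> 1"
        then show "\<bar>variogram M X t (t + s) / s powr \<alpha> t - c t\<bar> < \<epsilon>"
          using \<delta>(2)[of t s] by simp
      qed
    qed
  qed (use stat \<alpha>_strict_min C2 dens design variogram_continuous[OF stat] variogram_nonneg
       in \<open>auto simp: locally_stationary_def\<close>)
  define E where "E = (\<lambda>n. LBINT t:{0..1}. (\<integral>\<omega>. (X t \<omega> - Xn n t \<omega>)\<^sup>2 \<partial>M))"
  define \<kappa> where "\<kappa> = c 0 / (\<alpha> 0 + 1) * (Gamma (1 / \<gamma> + 1) / (p 0 powr \<alpha> 0 * b powr (1 / \<gamma>)))"
  have E: "E n = (\<Sum>j<n. integral {\<tau> n j..\<tau> n (Suc j)} (variogram M X (\<tau> n j)))" if n: "n \<ge> 1" for n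
    unfolding E_def
  proof (rule piecewise_continuous_integral[OF knots_sampling_design[OF n]])
    fix j assume j: "j < n"
    show "continuous_on {\<tau> n j..\<tau> n (Suc j)} (variogram M X (\<tau> n j))"
      by (rule continuous_on_subset[OF V_cont])
         (use knot_range[of j n] knot_range[of "Suc j" n] j in auto)
    fix t assume "\<tau> n j \<le> t" "t < \<tau> n (Suc j)"
    then have "Xn n t = X (\<tau> n j)"
      using approx[OF n] j unfolding piecewise_constant_approx_def
      by (auto dest: bspec[of _ _ "Suc j"])
    then show "(\<integral>\<omega>. (X t \<omega> - Xn n t \<omega>)\<^sup>2 \<partial>M) = variogram M X (\<tau> n j) t"
      by (simp add: variogram_def)
  qed
  have "\<forall>\<^sub>F n in sequentially. real n powr \<alpha> 0 * zoom n *
      (\<Sum>j<n. integral {\<tau> n j..\<tau> n (Suc j)} (variogram M X (\<tau> n j))) = real n powr \<alpha> 0 * zoom n * E n"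
    using eventually_ge_at_top[of 1] by eventually_elim (simp add: E)
  then have lim: "(\<lambda>n. real n powr \<alpha> 0 * zoom n * E n) \<longlonglongrightarrow> \<kappa>"
    using cell_sum_limit unfolding \<kappa>_def by (rule Lim_transform_eventually[rotated])
  have "\<kappa> > 0"
  proof -
    have "Gamma (1 / \<gamma> + 1) > 0" using \<gamma>_pos by (intro Gamma_real_pos add_pos_pos) auto
    moreover have "c 0 > 0" "\<alpha> 0 > 0" "p 0 > 0"
      using c_pos[of 0] \<alpha>_range[of 0] dens by (auto simp: positive_continuous_density_def)
    ultimately show ?thesis using b_pos by (simp add: \<kappa>_def)
  qed
  then have "(\<lambda>n. real n powr \<alpha> 0 * zoom n * E n / \<kappa>) \<longlonglongrightarrow> \<kappa> / \<kappa>"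
    by (intro tendsto_divide lim tendsto_const) auto
  then have "(\<lambda>n. E n / (\<kappa> / (real n powr \<alpha> 0 * zoom n))) \<longlonglongrightarrow> 1"
    using \<open>\<kappa> > 0\<close> by (simp add: mult.commute)
  then have "E \<sim>[sequentially] (\<lambda>n. \<kappa> / (real n powr \<alpha> 0 * zoom n))"
    by (rule asymp_equivI')
  then show ?thesis
    unfolding E_def \<kappa>_def zoom_def .
qed

end
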